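(* Let $F$ be a field, let $f(x)\in F[x]$ be a nonconstant polynomial, and put $n:=\deg(f(x))\geq 1$. If $p$ is a prime integer dividing $n$, then there exists an algebraic field extension $K/F$ such that $f(x)$ has a factor of degree $p$ in $K[x]$, with $[K:F]\leq \binom{n}{p}$ and $\nu_p([K:F])<\nu_p(n)$.
   Context: For a prime integer $p$ and a positive integer $m$, $\nu_p(m)$ denotes the $p$-adic valuation of $m$, i.e. the largest integer exponent $k$ such that $p^k\mid m$. The field $F$ is arbitrary. *)

theory Defs
  imports
    "HOL-Algebra.Algebraic_Closure_Type"
    "HOL-Computational_Algebra.Computational_Algebra"
begin

text \<open>
  The base field \<open>F\<close> is the type \<open>'a\<close> of class \<^class>\<open>field\<close>. Every algebraic extension of \<open>F\<close>
  is \<open>F\<close>-isomorphic to an intermediate field of \<open>F\<close> and the algebraic closure \<^typ>\<open>'a alg_closure\<close>,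
  so extensions \<open>K/F\<close> are represented by subsets of that type, with \<open>F\<close> embedded by \<^const>\<open>to_ac\<close>.
\<close>

definition extension_field :: "'a::field alg_closure set \<Rightarrow> bool" where
  "extension_field K \<longleftrightarrow>
     range to_ac \<subseteq> K \<and>
     (\<forall>x\<in>K. \<forall>y\<in>K. x + y \<in> K \<and> x * y \<in> K) \<and>
     (\<forall>x\<in>K. - x \<in> K \<and> inverse x \<in> K)"

definition algebraic_extension :: "'a::field alg_closure set \<Rightarrow> bool" where
  "algebraic_extension K \<longleftrightarrow>
     extension_field K \<and>
     (\<forall>x\<in>K. \<exists>q :: 'a poly. q \<noteq> 0 \<and> poly (map_poly to_ac q) x = 0)"

definition ac_scale :: "'a::field \<Rightarrow> 'a alg_closure \<Rightarrow> 'a alg_closure" where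
  "ac_scale a x = to_ac a * x"

global_interpretation ac: vector_space ac_scale
  by standard (simp_all add: ac_scale_def algebra_simps)

definition finite_extension :: "'a::field alg_closure set \<Rightarrow> bool" where
  "finite_extension K \<longleftrightarrow> extension_field K \<and> (\<exists>B. finite B \<and> ac.span B = K)"

text \<open>
  The degree \<open>[K:F]\<close>. It takes the value \<open>0\<close> when \<open>K\<close> is infinite over \<open>F\<close>, so a bound on it is only
  meaningful together with \<^const>\<open>finite_extension\<close>.
\<close>

definition ext_degree :: "'a::field alg_closure set \<Rightarrow> nat" where
  "ext_degree K = ac.dim K"

text \<open>\<open>g\<close> lies in \<open>K[x]\<close> and divides \<open>f\<close> there: the cofactor is also required to lie in \<open>K[x]\<close>.\<close>

definition factor_over ::
  "'a::field alg_closure set \<Rightarrow> 'a alg_closure poly \<Rightarrow> 'a poly \<Rightarrow> bool" where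
  "factor_over K g f \<longleftrightarrow>
     set (coeffs g) \<subseteq> K \<and>
     (\<exists>h. set (coeffs h) \<subseteq> K \<and> map_poly to_ac f = g * h)"

end

theory Submission
  imports Defs "Jordan_Normal_Form.Determinant" "HOL-Library.Function_Algebras"
begin

text \<open>
  Let \<open>r\<^sub>0, \<dots>, r\<^sub>n\<^sub>-\<^sub>1\<close> be the roots of \<open>f\<close> in the algebraic closure. The coefficients of
  \<open>\<Lambda>\<^sup>p (t - x)\<close> act on \<open>V = \<Lambda>\<^sup>p (F[x]/(f))\<close>, a vector space over \<open>F\<close> of dimension \<open>n choose p\<close>. Minors of
  divided differences give \<open>F\<close>-linear functionals \<open>L\<^sub>S\<close> from \<open>V\<close> to the closure, one for every \<open>p\<close>-subset
  \<open>S\<close> of the indices; they are jointly injective and form a triangular system of eigenfunctionals whose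
  eigenvalues are the coefficients of \<open>g\<^sub>S = (\<Prod>s\<in>S. x - r\<^sub>s)\<close>. So \<open>V\<close> is filtered with quotients \<open>Y\<^sub>S\<close>, the image
  of \<open>L\<^sub>S\<close> on the common kernel of the preceding functionals, and \<open>Y\<^sub>S\<close> is a vector space over the field
  \<open>K\<^sub>S = {x. x Y\<^sub>S \<subseteq> Y\<^sub>S}\<close>, which contains the coefficients of \<open>g\<^sub>S\<close>. Hence \<open>n choose p\<close> is a sum of
  multiples of the degrees \<open>[K\<^sub>S : F]\<close>. As its \<open>p\<close>-adic valuation is one less than that of \<open>n\<close>,
  some \<open>K\<^sub>S\<close> has the required degree.
\<close>

subsection \<open>Linear algebra over the base field\<close>

context vector_space
begin

text \<open>The ambient space may have infinite dimension, so finiteness is attached to a subspace.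
  Asking only for containment in a finite span makes it pass to smaller subspaces at once.\<close>

definition fin_gen :: "'b set \<Rightarrow> bool" where
  "fin_gen W \<longleftrightarrow> subspace W \<and> (\<exists>B. finite B \<and> W \<subseteq> span B)"

lemma fin_gen_subspace: "local.fin_gen W \<Longrightarrow> subspace W"
  by (simp add: local.fin_gen_def)

lemma fin_gen_subset:
  assumes "local.fin_gen W" "subspace U" "U \<subseteq> W"
  shows "local.fin_gen U"
  using assms unfolding local.fin_gen_def by blast

text \<open>An independent set inside a finite span is no larger than the spanning set, so a maximal
  independent subset of \<open>W\<close> is a finite basis.\<close>

lemma fin_gen_basisE:
  assumes "local.fin_gen W"
  obtains B where "finite B" "independent B" "span B = W" "card B = dim W"
proof -
  from assms obtain G where G: "finite G" "W \<subseteq> span G" and W: "subspace W"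
    unfolding local.fin_gen_def by blast
  obtain B where B: "B \<subseteq> W" "independent B" "W \<subseteq> span B"
    using maximal_independent_subset by blast
  have "finite B"
    using independent_span_bound[OF G(1) B(2)] B(1) G(2) by blast
  moreover have "span B = W"
    using B W by (meson span_minimal subset_antisym)
  moreover have "card B = dim W"
    using B basis_card_eq_dim by blast
  ultimately show ?thesis using B that by blast
qed

text \<open>In a vanishing combination the \<open>B\<close> part is minus the \<open>C\<close> part,
  hence lies in both spans and is zero.\<close>

lemma independent_Un_direct:
  assumes B: "finite B" "independent B" and C: "finite C" "independent C"
    and BC: "span B \<inter> span C \<subseteq> {0}"
  shows "independent (B \<union> C)" "B \<inter> C = {}"
proof -
  have "0 \<notin> B"
    using B(2) dependent_zero by blast
  then show disj: "B \<inter> C = {}"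
    using BC span_base by blast
  show "independent (B \<union> C)"
  proof (rule independent_if_scalars_zero)
    show "finite (B \<union> C)" using B C by simp
    fix u x assume s: "(\<Sum>x\<in>B \<union> C. scale (u x) x) = 0" and x: "x \<in> B \<union> C"
    let ?b = "\<Sum>x\<in>B. scale (u x) x" and ?c = "\<Sum>x\<in>C. scale (u x) x"
    have sum: "?b + ?c = 0"
      using s B C disj by (simp add: sum.union_disjoint)
    have b: "?b \<in> span B" and c: "?c \<in> span C"
      by (intro span_sum span_scale span_base; assumption)+
    have "?b = - ?c" using sum by (simp add: eq_neg_iff_add_eq_0)
    then have "?b \<in> span C" using c span_neg by metis
    then have "?b = 0" using b BC by blast
    then have "?c = 0" using sum by simp
    show "u x = 0"
      using x \<open>?b = 0\<close> \<open>?c = 0\<close> independentD[OF B(2,1) subset_refl, of u x]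
        independentD[OF C(2,1) subset_refl, of u x] by blast
  qed
qed

lemma dim_direct_sum:
  assumes U: "local.fin_gen U" and V: "local.fin_gen V" and UV: "U \<inter> V \<subseteq> {0}"
    and W: "subspace W" "U \<subseteq> W" "V \<subseteq> W" "\<And>w. w \<in> W \<Longrightarrow> \<exists>u\<in>U. \<exists>v\<in>V. w = u + v"
  shows "dim W = dim U + dim V"
proof -
  obtain B where B: "finite B" "independent B" "span B = U" "card B = dim U"
    using U local.fin_gen_basisE by blast
  obtain C where C: "finite C" "independent C" "span C = V" "card C = dim V"
    using V local.fin_gen_basisE by blast
  note ind = local.independent_Un_direct[OF B(1,2) C(1,2)]
  have "span (B \<union> C) = W"
  proof
    show "span (B \<union> C) \<subseteq> W"
      using B(3) C(3) W(1-3) by (intro span_minimal) (use span_base in blast)+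
    show "W \<subseteq> span (B \<union> C)"
    proof
      fix w assume "w \<in> W"
      then obtain u v where "u \<in> span B" "v \<in> span C" "w = u + v"
        using W(4) B(3) C(3) by blast
      then show "w \<in> span (B \<union> C)"
        by (metis span_add span_mono subsetD Un_upper1 Un_upper2)
    qed
  qed
  moreover have "independent (B \<union> C)" "B \<inter> C = {}"
    using ind UV B(3) C(3) by blast+
  ultimately show ?thesis
    using dim_span_eq_card_independent[of "B \<union> C"] card_Un_disjoint[OF B(1) C(1)] B(4) C(4)
    by simp
qed

lemma fin_gen_dim_mono:
  assumes "local.fin_gen W" "subspace U" "U \<subseteq> W"
  shows "dim U \<le> dim W"
proof -
  obtain B where B: "finite B" "independent B" "span B = U" "card B = dim U"
    using local.fin_gen_basisE[OF local.fin_gen_subset[OF assms]] by blast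
  obtain C where C: "finite C" "independent C" "span C = W" "card C = dim W"
    using local.fin_gen_basisE[OF assms(1)] by blast
  show ?thesis
    using independent_span_bound[OF C(1) B(2)] B C assms(3) span_superset by (metis subset_trans)
qed

lemma fin_gen_dim_eq_0:
  assumes "local.fin_gen W" "dim W = 0" shows "W = {0}"
  using local.fin_gen_basisE[OF assms(1)] assms(2) by (metis card_0_eq span_empty)

end

context vector_space_pair
begin

text \<open>Lifting a basis \<open>C\<close> of the image gives a linear section \<open>h\<close> of
  \<open>L\<close>. The splitting of \<open>w\<close> into \<open>w - h (L w)\<close> and
  \<open>h (L w)\<close> exhibits \<open>W\<close> as the direct sum of the kernel and a copy of the
  image.\<close>

lemma rank_nullity:
  assumes L: "Vector_Spaces.linear s1 s2 L" and W: "vs1.fin_gen W"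
  shows "vs2.fin_gen (L ` W)"
    and "vs1.dim W = vs1.dim {w \<in> W. L w = 0} + vs2.dim (L ` W)"
proof -
  have Ws: "vs1.subspace W" using W by (rule vs1.fin_gen_subspace)
  have kers: "vs1.subspace {w \<in> W. L w = 0}"
    using Ws by (auto simp: vs1.subspace_def linear_add[OF L] linear_scale[OF L] linear_0[OF L])
  then have ker: "vs1.fin_gen {w \<in> W. L w = 0}"
    using vs1.fin_gen_subset[OF W] by auto
  obtain B where B: "finite B" "vs1.independent B" "vs1.span B = W"
    using vs1.fin_gen_basisE[OF W] by blast
  show img: "vs2.fin_gen (L ` W)"
    unfolding vs2.fin_gen_def
    by (metis B(1,3) L Ws finite_imageI linear_span_image linear_subspace_image order_refl)
  then obtain C where C: "finite C" "vs2.independent C" "vs2.span C = L ` W" "card C = vs2.dim (L ` W)"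
    using vs2.fin_gen_basisE by blast
  have "\<forall>c\<in>C. \<exists>w\<in>W. L w = c"
    using C(3) vs2.span_base by fastforce
  then obtain g where g: "\<And>c. c \<in> C \<Longrightarrow> g c \<in> W" "\<And>c. c \<in> C \<Longrightarrow> L (g c) = c"
    by metis
  interpret r: vector_space_pair s2 s1 ..
  define h where "h = r.construct C g"
  have h: "Vector_Spaces.linear s2 s1 h"
    unfolding h_def using r.linear_construct[OF C(2)] .
  have hc: "h c = g c" if "c \<in> C" for c
    unfolding h_def using r.construct_basis[OF C(2) that] .
  have Lh: "L (h y) = y" if "y \<in> vs2.span C" for y
  proof -
    interpret s: vector_space_pair s2 s2 ..
    have "(L \<circ> h) y = id y"
      using that
    proof (rule s.linear_eq_on[rotated 2])
      show "Vector_Spaces.linear s2 s2 (L \<circ> h)" using h L by (rule Vector_Spaces.linear_compose)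
      show "Vector_Spaces.linear s2 s2 id" by (rule vs2.linear_id)
    qed (use hc g in auto)
    then show ?thesis by simp
  qed
  have hCW: "h ` vs2.span C \<subseteq> W"
    unfolding r.linear_span_image[OF h, symmetric]
    using Ws hc g by (intro vs1.span_minimal) auto
  have injh: "inj_on h (vs2.span C)"
    using Lh by (metis inj_onI)
  have indep: "vs1.independent (h ` C)"
    using r.linear_independent_injective_image[OF h C(2) injh] .
  have injC: "inj_on h C" using injh vs2.span_superset inj_on_subset by blast
  have hs: "vs1.span (h ` C) = h ` vs2.span C"
    by (rule r.linear_span_image[OF h])
  have "vs1.fin_gen (h ` vs2.span C)"
    unfolding vs1.fin_gen_def using hs C(1) by (metis finite_imageI order_refl vs1.subspace_span)
  moreover have "{w \<in> W. L w = 0} \<inter> h ` vs2.span C \<subseteq> {0}"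
    using Lh r.linear_0[OF h] by auto
  moreover have "\<exists>u\<in>{w \<in> W. L w = 0}. \<exists>v\<in>h ` vs2.span C. w = u + v" if w: "w \<in> W" for w
  proof -
    have Lw: "L w \<in> vs2.span C" using C(3) w by blast
    have "w - h (L w) \<in> {w \<in> W. L w = 0}"
      using w hCW Lw Lh[OF Lw] vs1.subspace_diff[OF Ws] linear_diff[OF L] by auto
    then show ?thesis using Lw by force
  qed
  ultimately have "vs1.dim W = vs1.dim {w \<in> W. L w = 0} + vs1.dim (h ` vs2.span C)"
    using vs1.dim_direct_sum[OF ker _ _ Ws, of "h ` vs2.span C"] hCW by blast
  also have "vs1.dim (h ` vs2.span C) = card C"
    using hs indep injC by (metis card_image vs1.dim_span_eq_card_independent)
  finally show "vs1.dim W = vs1.dim {w \<in> W. L w = 0} + vs2.dim (L ` W)"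
    using C(4) by simp
qed

end

section \<open>Multiplier fields of subspaces of the algebraic closure\<close>

text \<open>For a subspace \<open>Y\<close> this is the largest subring of the closure over which
  \<open>Y\<close> is a module.\<close>

definition multipliers :: "'a::field alg_closure set \<Rightarrow> 'a alg_closure set" where
  "multipliers Y = {x. \<forall>y\<in>Y. x * y \<in> Y}"

lemma linear_ac_mult: "Vector_Spaces.linear ac_scale ac_scale (\<lambda>x. x * y)"
  by unfold_locales (simp_all add: ac_scale_def algebra_simps)

lemma ac_pair: "vector_space_pair ac_scale ac_scale" ..

lemma ac_dim_0: "ac.dim {0} = 0"
  using ac.dim_le_card[of "{0}" "{}"] by simp

lemma ac_image_mult:
  assumes K: "ac.fin_gen K" and y: "y \<noteq> 0"
  shows "ac.fin_gen ((\<lambda>x. x * y) ` K)" "ac.dim ((\<lambda>x. x * y) ` K) = ac.dim K"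
proof -
  interpret vector_space_pair ac_scale ac_scale by (rule ac_pair)
  note rn = rank_nullity[OF linear_ac_mult[of y] K]
  show "ac.fin_gen ((\<lambda>x. x * y) ` K)" by (rule rn)
  have "{w \<in> K. w * y = 0} = {0}"
    using y ac.subspace_0[OF ac.fin_gen_subspace[OF K]] by auto
  then have "ac.dim {w \<in> K. w * y = 0} = 0"
    by (simp only: ac_dim_0)
  then show "ac.dim ((\<lambda>x. x * y) ` K) = ac.dim K"
    using rn(2) by simp
qed

text \<open>Only inverses need an argument: multiplication by a nonzero multiplier is an injective
  linear map of the finite-dimensional \<open>Y\<close> into itself, hence onto, so its inverse also
  preserves \<open>Y\<close>.\<close>

lemma multipliers_extension_field:
  fixes Y :: "'a::field alg_closure set"
  assumes Y: "ac.fin_gen Y"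
  shows "extension_field (multipliers Y)"
proof -
  have Ys: "ac.subspace Y" using Y by (rule ac.fin_gen_subspace)
  have "inverse x \<in> multipliers Y" if x: "x \<in> multipliers Y" for x
  proof (cases "x = 0")
    case False
    have sub: "(\<lambda>y. y * x) ` Y \<subseteq> Y" using x by (auto simp: multipliers_def mult.commute)
    note im = ac_image_mult[OF Y False]
    have "(\<lambda>y. y * x) ` Y = Y"
    proof (rule ccontr)
      assume "(\<lambda>y. y * x) ` Y \<noteq> Y"
      \<comment> \<open>A vector \<open>z\<close> missed by the map would enlarge a basis of the
        image, already of size \<open>ac.dim Y\<close>, to an independent subset of
        \<open>Y\<close>.\<close>
      then obtain z where z: "z \<in> Y" "z \<notin> (\<lambda>y. y * x) ` Y" using sub by blast
      obtain B where B: "finite B" "ac.independent B" "ac.span B = (\<lambda>y. y * x) ` Y"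
          "card B = ac.dim ((\<lambda>y. y * x) ` Y)"
        using ac.fin_gen_basisE[OF im(1)] by blast
      have "ac.independent (insert z B)"
        using B z ac.independent_insertI by blast
      moreover have "card (insert z B) = Suc (ac.dim Y)"
        using B z im(2) ac.span_base by (metis card_insert_disjoint)
      moreover have "ac.span (insert z B) \<subseteq> Y"
        using z B(3) sub Ys ac.span_base by (intro ac.span_minimal) blast+
      ultimately show False
        using ac.fin_gen_dim_mono[OF Y ac.subspace_span, of "insert z B"]
        by (simp add: ac.dim_eq_card_independent)
    qed
    show ?thesis
      unfolding multipliers_def
    proof safe
      fix y assume "y \<in> Y"
      then obtain z where "z \<in> Y" "y = z * x"
        using \<open>(\<lambda>y. y * x) ` Y = Y\<close> by blast
      then show "inverse x * y \<in> Y" using False by (simp add: mult.left_commute)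
    qed
  qed (use x in \<open>simp add: multipliers_def\<close>)
  then show ?thesis
    using Ys unfolding extension_field_def
    by (auto simp: multipliers_def algebra_simps ac.subspace_def ac_scale_def ac.subspace_neg[OF Ys])
qed

text \<open>\<open>Y\<close> is a vector space over the field \<open>multipliers Y\<close>, so its
  dimension over the base field is a multiple of the degree of that field.\<close>

lemma dim_multipliers_dvd:
  fixes Y :: "'a::field alg_closure set"
  assumes Y: "ac.fin_gen Y" and ne: "Y \<noteq> {0}"
  shows "ac.fin_gen (multipliers Y)" "ac.dim (multipliers Y) > 0"
    "ac.dim (multipliers Y) dvd ac.dim Y"
proof -
  let ?K = "multipliers Y"
  have Ys: "ac.subspace Y" using Y by (rule ac.fin_gen_subspace)
  have ext: "extension_field ?K" by (rule multipliers_extension_field[OF Y])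
  have Ks: "ac.subspace ?K"
    using ext unfolding ac.subspace_def extension_field_def ac_scale_def
    by (metis (no_types, lifting) range_subsetD to_ac_0)
  obtain y where y: "y \<in> Y" "y \<noteq> 0" using ne ac.subspace_0[OF Ys] by blast
  \<comment> \<open>A fixed nonzero \<open>y\<close> in \<open>Y\<close> embeds the multipliers into
    \<open>Y\<close> by \<open>x \<mapsto> x * y\<close>, which bounds their dimension.\<close>
  have "(\<lambda>x. x * inverse y) ` Y \<supseteq> ?K"
  proof
    fix x assume "x \<in> ?K"
    then have "x * y \<in> Y" using y by (simp add: multipliers_def)
    then show "x \<in> (\<lambda>x. x * inverse y) ` Y"
      using y(2) by (auto intro!: image_eqI[of _ _ "x * y"])
  qed
  then show K: "ac.fin_gen ?K"
    using ac.fin_gen_subset[OF ac_image_mult(1)[OF Y] Ks, of "inverse y"] y(2) by simp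
  have "1 \<in> ?K" by (simp add: multipliers_def)
  then show pos: "ac.dim ?K > 0"
    using ac.fin_gen_dim_eq_0[OF K] by fastforce
  \<comment> \<open>In place of a basis over \<open>?K\<close>, take a \<open>?K\<close>-stable
    subspace \<open>Z\<close> of maximal dimension with the divisibility. If \<open>Z\<close> were
    proper, adding the line \<open>?K * w\<close> through some \<open>w\<close> outside it would
    raise the dimension by exactly \<open>ac.dim ?K\<close>.\<close>
  define P where "P Z \<longleftrightarrow> ac.subspace Z \<and> Z \<subseteq> Y \<and> (\<forall>x\<in>?K. \<forall>z\<in>Z. x * z \<in> Z) \<and> ac.dim ?K dvd ac.dim Z"
    for Z
  have "P {0}"
    unfolding P_def using ac.subspace_0[OF Ys] by (simp add: ac.subspace_single_0 ac_dim_0)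
  moreover have "ac.dim Z < Suc (ac.dim Y)" if "P Z" for Z
    using ac.fin_gen_dim_mono[OF Y] that by (simp add: P_def less_Suc_eq_le)
  ultimately obtain Z where Z: "P Z" and max: "\<And>Z'. P Z' \<Longrightarrow> ac.dim Z' \<le> ac.dim Z"
    using ex_has_greatest_nat[of P "{0}" ac.dim "Suc (ac.dim Y)"] by metis
  have "Z = Y"
  proof (rule ccontr)
    assume "Z \<noteq> Y"
    then obtain w where w: "w \<in> Y" "w \<notin> Z" using Z by (auto simp: P_def)
    have Zs: "ac.subspace Z" and ZK: "\<And>x z. x \<in> ?K \<Longrightarrow> z \<in> Z \<Longrightarrow> x * z \<in> Z"
      using Z by (auto simp: P_def)
    have w0: "w \<noteq> 0" using w(2) Zs ac.subspace_0 by blast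
    let ?V = "(\<lambda>x. x * w) ` ?K"
    note im = ac_image_mult[OF K w0]
    let ?Z = "{x + y |x y. x \<in> Z \<and> y \<in> ?V}"
    have Zg: "ac.fin_gen Z" using Z ac.fin_gen_subset[OF Y] by (auto simp: P_def)
    \<comment> \<open>If a nonzero multiple of \<open>w\<close> were in \<open>Z\<close>, dividing
      by the scalar, which is possible inside \<open>?K\<close>, would put \<open>w\<close> in
      \<open>Z\<close>.\<close>
    have int: "Z \<inter> ?V \<subseteq> {0}"
    proof
      fix z assume z: "z \<in> Z \<inter> ?V"
      then obtain x where x: "x \<in> ?K" "z = x * w" by blast
      have "x = 0"
      proof (rule ccontr)
        assume "x \<noteq> 0"
        then have "w = inverse x * z" using x(2) by simp
        moreover have "inverse x \<in> ?K" using ext x(1) by (auto simp: extension_field_def)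
        ultimately show False using ZK z w(2) by blast
      qed
      then show "z \<in> {0}" using x by simp
    qed
    have Z's: "ac.subspace ?Z"
      using ac.subspace_sums[OF Zs ac.fin_gen_subspace[OF im(1)]] .
    have V0: "0 \<in> ?V" using ac.subspace_0[OF ac.fin_gen_subspace[OF im(1)]] .
    have sub: "Z \<subseteq> ?Z" "?V \<subseteq> ?Z"
      using V0 ac.subspace_0[OF Zs] by force+
    have dimZ': "ac.dim ?Z = ac.dim Z + ac.dim ?K"
      using ac.dim_direct_sum[OF Zg im(1) int Z's sub] im(2) by auto
    have "P ?Z"
      unfolding P_def
    proof (intro conjI ballI)
      show "?Z \<subseteq> Y"
        using Z w(1) ac.subspace_add[OF Ys] by (auto simp: P_def multipliers_def)
      show "ac.dim ?K dvd ac.dim ?Z" using Z dimZ' by (simp add: P_def)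
      fix x z assume "x \<in> ?K" "z \<in> ?Z"
      then obtain a b where ab: "a \<in> Z" "b \<in> ?K" "z = a + b * w" by blast
      have "x * z = x * a + (x * b) * w" using ab by (simp add: algebra_simps)
      moreover have "x * b \<in> ?K" using \<open>x \<in> ?K\<close> ab(2) ext by (auto simp: extension_field_def)
      ultimately show "x * z \<in> ?Z" using ZK[OF \<open>x \<in> ?K\<close> ab(1)] by blast
    qed (rule Z's)
    then show False using max dimZ' pos by fastforce
  qed
  then show "ac.dim ?K dvd ac.dim Y" using Z by (simp add: P_def)
qed

text \<open>
  Split off a functional \<open>L i\<close> of minimal rank: its image \<open>L i ` W\<close> is a vector space over the field
  \<open>multipliers (L i ` W)\<close>, which contains all \<open>c i k\<close>, and the other functionals remain triangular on its
  kernel.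
\<close>

lemma triangular_eigenfunctionals:
  fixes s :: "'a::field \<Rightarrow> 'v::ab_group_add \<Rightarrow> 'v" and L :: "'i \<Rightarrow> 'v \<Rightarrow> 'a alg_closure"
    and rank :: "'i \<Rightarrow> nat"
  assumes vs: "vector_space s" and J: "finite J"
    and lin: "\<And>i. i \<in> J \<Longrightarrow> Vector_Spaces.linear s ac_scale (L i)"
    and W: "vector_space.fin_gen s W" and E: "\<And>k w. w \<in> W \<Longrightarrow> E k w \<in> W"
    and eigen: "\<And>i k w. i \<in> J \<Longrightarrow> w \<in> W \<Longrightarrow> (\<And>j. j \<in> J \<Longrightarrow> rank j < rank i \<Longrightarrow> L j w = 0) \<Longrightarrow>
                  L i (E k w) = c i k * L i w"
    and inj: "\<And>w. w \<in> W \<Longrightarrow> (\<And>i. i \<in> J \<Longrightarrow> L i w = 0) \<Longrightarrow> w = 0"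
    and q: "\<not> q dvd vector_space.dim s W"
  shows "\<exists>i\<in>J. \<exists>K. extension_field K \<and> ac.fin_gen K \<and> range (c i) \<subseteq> K \<and>
           ac.dim K > 0 \<and> \<not> q dvd ac.dim K \<and> ac.dim K \<le> vector_space.dim s W"
  using J lin W E eigen inj q
proof (induction J arbitrary: W rule: finite_psubset_induct)
  case (psubset J)
  interpret vector_space_pair s ac_scale
    using vs ac.vector_space_axioms by (rule vector_space_pair.intro)
  show ?case
  proof (cases "J = {}")
    case True
    then have "W \<subseteq> {0}" using psubset.prems(5) by blast
    then have "vs1.dim W \<le> card ({} :: 'v set)" by (intro vs1.dim_le_card) auto
    then show ?thesis using psubset.prems(6) by simp
  next
    case False
    \<comment> \<open>No functional precedes one of minimal rank, so the eigenvalue equation for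
      \<open>L i\<close> holds on all of \<open>W\<close>.\<close>
    then obtain i where i: "i \<in> J" and min: "\<And>j. j \<in> J \<Longrightarrow> rank i \<le> rank j"
      using ex_has_least_nat[of "\<lambda>i. i \<in> J" _ rank] by blast
    define U where "U = {w \<in> W. L i w = 0}"
    note Li = psubset.prems(1)[OF i]
    note rn = rank_nullity[OF Li psubset.prems(2), folded U_def]
    have LE: "L i (E k w) = c i k * L i w" if "w \<in> W" for k w
      using psubset.prems(4)[OF i that] min by (meson leD)
    have Ws: "vs1.subspace W" using psubset.prems(2) by (rule vs1.fin_gen_subspace)
    have Us: "vs1.subspace U"
      using Ws unfolding U_def
      by (auto simp: vs1.subspace_def linear_add[OF Li] linear_scale[OF Li] linear_0[OF Li])
    have U: "vs1.fin_gen U" using vs1.fin_gen_subset[OF psubset.prems(2) Us] by (auto simp: U_def)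
    \<comment> \<open>Since \<open>dim W\<close> is the sum of \<open>dim U\<close> and the
      dimension of the image, \<open>q\<close> fails to divide one of them: recurse on
      \<open>U\<close> in the first case, use the multipliers of the image in the second.\<close>
    show ?thesis
    proof (cases "q dvd vs1.dim U")
      case False
      have "\<exists>i'\<in>J - {i}. \<exists>K. extension_field K \<and> ac.fin_gen K \<and> range (c i') \<subseteq> K \<and>
           ac.dim K > 0 \<and> \<not> q dvd ac.dim K \<and> ac.dim K \<le> vs1.dim U"
      proof (rule psubset.IH[OF _ _ U _ _ _ False])
        show "J - {i} \<subset> J" using i by blast
        show "Vector_Spaces.linear s ac_scale (L j)" if "j \<in> J - {i}" for j
          using psubset.prems(1) that by blast
        show "E k w \<in> U" if "w \<in> U" for k w
          using that psubset.prems(3) LE by (auto simp: U_def)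
        show "L j (E k w) = c j k * L j w" if "j \<in> J - {i}" "w \<in> U"
            "\<And>l. l \<in> J - {i} \<Longrightarrow> rank l < rank j \<Longrightarrow> L l w = 0" for j k w
          using psubset.prems(4)[of j w k] that by (auto simp: U_def)
        show "w = 0" if "w \<in> U" "\<And>j. j \<in> J - {i} \<Longrightarrow> L j w = 0" for w
          using psubset.prems(5)[of w] that by (auto simp: U_def)
      qed
      then show ?thesis using rn(2) by (metis DiffD1 le_add1 order_trans)
    next
      case True
      let ?Y = "L i ` W"
      have qY: "\<not> q dvd ac.dim ?Y" using True rn(2) psubset.prems(6) by (simp add: dvd_add_right_iff)
      then have ne: "?Y \<noteq> {0}" using ac_dim_0 by (metis dvd_0_right)
      note m = dim_multipliers_dvd[OF rn(1) ne]
      have Ypos: "ac.dim ?Y > 0" using qY by (metis dvd_0_right gr0I)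
      have "range (c i) \<subseteq> multipliers ?Y"
        using LE psubset.prems(3) by (auto simp: multipliers_def) (metis image_eqI)
      moreover have "ac.dim (multipliers ?Y) \<le> vs1.dim W"
        using dvd_imp_le[OF m(3) Ypos] rn(2) by simp
      ultimately show ?thesis
        using i m multipliers_extension_field[OF rn(1)] qY dvd_trans by metis
    qed
  qed
qed

subsection \<open>Compound matrices\<close>

definition subsets_of_card :: "nat \<Rightarrow> nat \<Rightarrow> nat set set" where
  "subsets_of_card n p = {S. S \<subseteq> {..<n} \<and> card S = p}"

lemma finite_subsets_of_card: "finite (subsets_of_card n p)"
  by (rule finite_subset[of _ "Pow {..<n}"]) (auto simp: subsets_of_card_def)

lemma card_subsets_of_card: "card (subsets_of_card n p) = n choose p"
  using n_subsets[of "{..<n}" p] by (simp add: subsets_of_card_def)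

lemma subsets_of_cardD:
  assumes "S \<in> subsets_of_card n p"
  shows "finite S" "card S = p" "S \<subseteq> {..<n}"
  using assms finite_subset by (auto simp: subsets_of_card_def)

definition ith_elem :: "nat set \<Rightarrow> nat \<Rightarrow> nat" where
  "ith_elem S i = sorted_list_of_set S ! i"

lemma bij_betw_ith_elem:
  assumes "finite S" "card S = p"
  shows "bij_betw (ith_elem S) {0..<p} S"
  using bij_betw_nth[of "sorted_list_of_set S" "{..<p}" S] assms
  by (simp add: ith_elem_def[abs_def] atLeast0LessThan)

lemma ith_elem_less:
  assumes "finite S" "card S = p" "i < j" "j < p"
  shows "ith_elem S i < ith_elem S j"
  using assms by (auto simp: ith_elem_def intro: sorted_wrt_nth_less[of "(<)"])

text \<open>For \<open>p\<close>-subsets \<open>S\<close> and \<open>T\<close> these are the entries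
  of the \<open>p\<close>-th compound matrix of \<open>A\<close>, that is, of the exterior power of
  \<open>A\<close> in the wedge basis.\<close>

definition minor :: "nat \<Rightarrow> (nat \<Rightarrow> nat \<Rightarrow> 'r::comm_ring_1) \<Rightarrow> nat set \<Rightarrow> nat set \<Rightarrow> 'r" where
  "minor p A S T = det (mat p p (\<lambda>(i, j). A (ith_elem S i) (ith_elem T j)))"

lemma det_mat_Leibniz:
  "det (mat p p (\<lambda>(i, j). M i j)) =
     (\<Sum>\<pi> | \<pi> permutes {0..<p}. signof \<pi> * (\<Prod>i = 0..<p. M i (\<pi> i)))"
  by (subst det_def'[of _ p]) (auto intro!: sum.cong prod.cong dest: permutes_in_image)

lemma (in comm_ring_hom) hom_minor: "hom (minor p A S T) = minor p (\<lambda>i j. hom (A i j)) S T"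
  unfolding minor_def hom_det[symmetric]
  by (rule arg_cong[where f = det]) auto

text \<open>Multilinear expansion of the rows: only injective choices of column indices survive.\<close>

lemma det_mat_sum_product:
  fixes A B :: "nat \<Rightarrow> nat \<Rightarrow> 'r::comm_ring_1"
  shows "det (mat p p (\<lambda>(i, j). \<Sum>k<n. A i k * B k j)) =
     (\<Sum>g | g \<in> {0..<p} \<rightarrow>\<^sub>E {..<n} \<and> inj_on g {0..<p}.
        (\<Prod>i = 0..<p. A i (g i)) * det (mat p p (\<lambda>(i, j). B (g i) j)))"
proof -
  let ?G = "{0..<p} \<rightarrow>\<^sub>E {..<n}"
  have fin: "finite ?G" by (intro finite_PiE) auto
  have expand: "(\<Prod>i = 0..<p. \<Sum>k<n. A i k * B k (\<pi> i)) =
      (\<Sum>g\<in>?G. \<Prod>i = 0..<p. A i (g i) * B (g i) (\<pi> i))" for \<pi>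
    by (rule prod_sum_PiE) auto
  have "det (mat p p (\<lambda>(i, j). \<Sum>k<n. A i k * B k j)) =
      (\<Sum>\<pi> | \<pi> permutes {0..<p}. signof \<pi> *
         (\<Sum>g\<in>?G. \<Prod>i = 0..<p. A i (g i) * B (g i) (\<pi> i)))"
    by (simp only: det_mat_Leibniz expand)
  also have "\<dots> = (\<Sum>\<pi> | \<pi> permutes {0..<p}. \<Sum>g\<in>?G. (\<Prod>i = 0..<p. A i (g i)) *
         (signof \<pi> * (\<Prod>i = 0..<p. B (g i) (\<pi> i))))"
    by (simp add: prod.distrib sum_distrib_left mult_ac)
  also have "\<dots> = (\<Sum>g\<in>?G. \<Sum>\<pi> | \<pi> permutes {0..<p}. (\<Prod>i = 0..<p. A i (g i)) *
         (signof \<pi> * (\<Prod>i = 0..<p. B (g i) (\<pi> i))))"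
    by (rule sum.swap)
  also have "\<dots> = (\<Sum>g\<in>?G. (\<Prod>i = 0..<p. A i (g i)) * det (mat p p (\<lambda>(i, j). B (g i) j)))"
    unfolding det_mat_Leibniz by (simp add: sum_distrib_left)
  also have "\<dots> = (\<Sum>g | g \<in> ?G \<and> inj_on g {0..<p}.
        (\<Prod>i = 0..<p. A i (g i)) * det (mat p p (\<lambda>(i, j). B (g i) j)))"
  proof (rule sum.mono_neutral_right[OF fin])
    show "{g. g \<in> ?G \<and> inj_on g {0..<p}} \<subseteq> ?G" by blast
  next
    show "\<forall>g\<in>?G - {g. g \<in> ?G \<and> inj_on g {0..<p}}.
        (\<Prod>i = 0..<p. A i (g i)) * det (mat p p (\<lambda>(i, j). B (g i) j)) = 0"
    proof
      fix g assume "g \<in> ?G - {g. g \<in> ?G \<and> inj_on g {0..<p}}"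
      then obtain i j where ij: "i < p" "j < p" "i \<noteq> j" "g i = g j"
        by (auto simp: inj_on_def)
      have "det (mat p p (\<lambda>(i, j). B (g i) j)) = 0"
        by (rule det_identical_rows[of _ p i j]) (use ij in auto)
      then show "(\<Prod>i = 0..<p. A i (g i)) * det (mat p p (\<lambda>(i, j). B (g i) j)) = 0" by simp
    qed
  qed
  finally show ?thesis .
qed

text \<open>Sorts the injective column choices by their image \<open>T\<close>: each is the
  increasing enumeration of \<open>T\<close> preceded by a permutation.\<close>

lemma bij_betw_permutations_injections:
  assumes T: "finite T" "card T = p" "T \<subseteq> {..<n}"
  shows "bij_betw (\<lambda>\<sigma>. \<lambda>i\<in>{0..<p}. ith_elem T (\<sigma> i)) {\<sigma>. \<sigma> permutes {0..<p}}
           {g. (g \<in> {0..<p} \<rightarrow>\<^sub>E {..<n} \<and> inj_on g {0..<p}) \<and> g ` {0..<p} = T}"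
proof -
  let ?e = "ith_elem T" and ?I = "{0..<p}"
  have e: "bij_betw ?e ?I T" using T by (intro bij_betw_ith_elem)
  \<comment> \<open>Outside \<open>?I\<close> a permutation must be the identity, whereas an
    extensional function is undefined there.\<close>
  let ?h = "\<lambda>g i. if i < p then inv_into ?I ?e (g i) else i"
  have einv: "inv_into ?I ?e (?e i) = i" if "i < p" for i
    using e that by (simp add: bij_betw_def)
  show ?thesis
  proof (rule bij_betwI[where g = ?h])
    show "(\<lambda>\<sigma>. \<lambda>i\<in>?I. ?e (\<sigma> i)) \<in> {\<sigma>. \<sigma> permutes ?I} \<rightarrow>
        {g. (g \<in> ?I \<rightarrow>\<^sub>E {..<n} \<and> inj_on g ?I) \<and> g ` ?I = T}"
    proof
      fix \<sigma> assume "\<sigma> \<in> {\<sigma>. \<sigma> permutes ?I}"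
      then have "bij_betw (?e \<circ> \<sigma>) ?I T"
        using e by (intro bij_betw_trans[of \<sigma> ?I ?I]) (auto intro: permutes_imp_bij)
      then have "bij_betw (\<lambda>i\<in>?I. ?e (\<sigma> i)) ?I T"
        by (rule bij_betw_cong[THEN iffD1, rotated]) auto
      then show "(\<lambda>i\<in>?I. ?e (\<sigma> i)) \<in> {g. (g \<in> ?I \<rightarrow>\<^sub>E {..<n} \<and> inj_on g ?I) \<and> g ` ?I = T}"
        using T(3) by (fastforce simp: bij_betw_def)
    qed
    show "?h \<in> {g. (g \<in> ?I \<rightarrow>\<^sub>E {..<n} \<and> inj_on g ?I) \<and> g ` ?I = T} \<rightarrow> {\<sigma>. \<sigma> permutes ?I}"
    proof
      fix g assume "g \<in> {g. (g \<in> ?I \<rightarrow>\<^sub>E {..<n} \<and> inj_on g ?I) \<and> g ` ?I = T}"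
      then have "bij_betw g ?I T" by (simp add: bij_betw_def)
      then have "bij_betw (inv_into ?I ?e \<circ> g) ?I ?I"
        using bij_betw_inv_into[OF e] by (rule bij_betw_trans)
      then have "bij_betw (?h g) ?I ?I"
        by (rule bij_betw_cong[THEN iffD1, rotated]) auto
      then show "?h g \<in> {\<sigma>. \<sigma> permutes ?I}"
        by (auto intro!: bij_imp_permutes)
    qed
    show "?h (\<lambda>i\<in>?I. ?e (\<sigma> i)) = \<sigma>" if "\<sigma> \<in> {\<sigma>. \<sigma> permutes ?I}" for \<sigma>
    proof
      fix i show "?h (\<lambda>i\<in>?I. ?e (\<sigma> i)) i = \<sigma> i"
        using that permutes_in_image[of \<sigma> ?I i] permutes_not_in[of \<sigma> ?I i] einv[of "\<sigma> i"] by auto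
    qed
    show "(\<lambda>i\<in>?I. ?e (?h g i)) = g"
      if "g \<in> {g. (g \<in> ?I \<rightarrow>\<^sub>E {..<n} \<and> inj_on g ?I) \<and> g ` ?I = T}" for g
    proof
      fix i
      have "?e (inv_into ?I ?e (g i)) = g i" if "i < p"
        using e that \<open>g \<in> _\<close> by (intro f_inv_into_f) (auto simp: bij_betw_def)
      then show "(\<lambda>i\<in>?I. ?e (?h g i)) i = g i"
        using that by (auto simp: PiE_def extensional_def)
    qed
  qed
qed

text \<open>The row expansion is a sum over injective choices of indices. Those with image
  \<open>T\<close> correspond to permutations, and together they give the product of the two minors
  through \<open>T\<close>.\<close>

theorem Cauchy_Binet:
  fixes A B :: "nat \<Rightarrow> nat \<Rightarrow> 'r::comm_ring_1"
  shows "minor p (\<lambda>i j. \<Sum>k<n. A i k * B k j) S U =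
     (\<Sum>T\<in>subsets_of_card n p. minor p A S T * minor p B T U)"
proof -
  let ?I = "{0..<p}"
  let ?G = "{g. g \<in> ?I \<rightarrow>\<^sub>E {..<n} \<and> inj_on g ?I}"
  let ?F = "\<lambda>g. (\<Prod>i = 0..<p. A (ith_elem S i) (g i)) * det (mat p p (\<lambda>(i, j). B (g i) (ith_elem U j)))"
  have fin: "finite ?G"
    by (rule finite_subset[of _ "?I \<rightarrow>\<^sub>E {..<n}"]) (auto intro!: finite_PiE)
  have img: "(\<lambda>g. g ` ?I) ` ?G \<subseteq> subsets_of_card n p"
    by (auto simp: subsets_of_card_def card_image)
  have "minor p (\<lambda>i j. \<Sum>k<n. A i k * B k j) S U = sum ?F ?G"
    unfolding minor_def
    using det_mat_sum_product[where A = "\<lambda>i. A (ith_elem S i)" and B = "\<lambda>k j. B k (ith_elem U j)"] .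
  also have "\<dots> = (\<Sum>T\<in>subsets_of_card n p. sum ?F {g \<in> ?G. g ` ?I = T})"
    by (rule sum.group[symmetric, OF fin finite_subsets_of_card img])
  also have "\<dots> = (\<Sum>T\<in>subsets_of_card n p. minor p A S T * minor p B T U)"
  proof (rule sum.cong[OF refl])
    fix T assume "T \<in> subsets_of_card n p"
    note T = subsets_of_cardD[OF this]
    have "minor p A S T * minor p B T U =
        (\<Sum>\<sigma> | \<sigma> permutes ?I. (\<Prod>i = 0..<p. A (ith_elem S i) (ith_elem T (\<sigma> i))) *
           (signof \<sigma> * minor p B T U))"
      unfolding minor_def[of p A] det_mat_Leibniz by (simp add: sum_distrib_right sum_distrib_left mult_ac)
    also have "\<dots> = (\<Sum>\<sigma> | \<sigma> permutes ?I. ?F (\<lambda>i\<in>?I. ith_elem T (\<sigma> i)))"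
    proof (rule sum.cong[OF refl])
      fix \<sigma> assume "\<sigma> \<in> {\<sigma>. \<sigma> permutes ?I}"
      then have \<sigma>: "\<sigma> permutes ?I" by simp
      let ?M = "mat p p (\<lambda>(i, j). B (ith_elem T i) (ith_elem U j))"
      \<comment> \<open>Reordering the rows of the \<open>B\<close> minor by \<sigma> produces
        exactly the sign in the Leibniz expansion of the \<open>A\<close> minor.\<close>
      have "signof \<sigma> * minor p B T U = det (mat p p (\<lambda>(i, j). ?M $$ (\<sigma> i, j)))"
        unfolding minor_def by (rule det_permute_rows[symmetric, OF _ \<sigma>]) simp
      also have "mat p p (\<lambda>(i, j). ?M $$ (\<sigma> i, j)) =
          mat p p (\<lambda>(i, j). B ((\<lambda>i\<in>?I. ith_elem T (\<sigma> i)) i) (ith_elem U j))"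
        using permutes_in_image[OF \<sigma>] by (intro eq_matI) auto
      finally have "signof \<sigma> * minor p B T U = det \<dots>" .
      moreover have "(\<Prod>i = 0..<p. A (ith_elem S i) (ith_elem T (\<sigma> i))) =
          (\<Prod>i = 0..<p. A (ith_elem S i) ((\<lambda>i\<in>?I. ith_elem T (\<sigma> i)) i))"
        by (rule prod.cong) auto
      ultimately show "(\<Prod>i = 0..<p. A (ith_elem S i) (ith_elem T (\<sigma> i))) * (signof \<sigma> * minor p B T U) =
          ?F (\<lambda>i\<in>?I. ith_elem T (\<sigma> i))"
        by (simp only:)
    qed
    also have "\<dots> = sum ?F {g \<in> ?G. g ` ?I = T}"
      using sum.reindex_bij_betw[OF bij_betw_permutations_injections[OF T], of ?F] by simp
    finally show "sum ?F {g \<in> ?G. g ` ?I = T} = minor p A S T * minor p B T U" ..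
  qed
  finally show ?thesis .
qed

text \<open>Some Leibniz term is nonzero, and its permutation pairs every element of
  \<open>S\<close> with an element of \<open>T\<close> that is no larger. Thus element sums order
  the \<open>p\<close>-subsets so that the compound is again triangular.\<close>

lemma minor_lower_triangular:
  fixes A :: "nat \<Rightarrow> nat \<Rightarrow> 'r::comm_ring_1"
  assumes A: "\<And>i j. i < j \<Longrightarrow> A i j = 0"
    and S: "finite S" "card S = p" and T: "finite T" "card T = p"
    and nz: "minor p A S T \<noteq> 0"
  shows "\<Sum>T \<le> \<Sum>S" "\<Sum>T = \<Sum>S \<Longrightarrow> T = S"
proof -
  have "\<exists>\<sigma>. \<sigma> permutes {0..<p} \<and> (\<Prod>i = 0..<p. A (ith_elem S i) (ith_elem T (\<sigma> i))) \<noteq> 0"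
  proof (rule ccontr)
    assume "\<nexists>\<sigma>. \<sigma> permutes {0..<p} \<and> (\<Prod>i = 0..<p. A (ith_elem S i) (ith_elem T (\<sigma> i))) \<noteq> 0"
    then have "minor p A S T = 0"
      unfolding minor_def det_mat_Leibniz by (intro sum.neutral) auto
    then show False using nz by blast
  qed
  then obtain \<sigma> where \<sigma>: "\<sigma> permutes {0..<p}"
      "(\<Prod>i = 0..<p. A (ith_elem S i) (ith_elem T (\<sigma> i))) \<noteq> 0"
    by blast
  have le: "ith_elem T (\<sigma> i) \<le> ith_elem S i" if i: "i \<in> {0..<p}" for i
  proof (rule ccontr)
    assume "\<not> ith_elem T (\<sigma> i) \<le> ith_elem S i"
    then have "A (ith_elem S i) (ith_elem T (\<sigma> i)) = 0" using A by simp
    then have "(\<Prod>i = 0..<p. A (ith_elem S i) (ith_elem T (\<sigma> i))) = 0"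
      using i by (intro prod_zero) auto
    then show False using \<sigma>(2) by blast
  qed
  have bS: "bij_betw (ith_elem S) {0..<p} S" using S by (rule bij_betw_ith_elem)
  have bT: "bij_betw (ith_elem T \<circ> \<sigma>) {0..<p} T"
    using permutes_imp_bij[OF \<sigma>(1)] bij_betw_ith_elem[OF T] by (rule bij_betw_trans)
  have sS: "\<Sum>S = (\<Sum>i = 0..<p. ith_elem S i)"
    using sum.reindex_bij_betw[OF bS, of "\<lambda>x. x"] by simp
  have sT: "\<Sum>T = (\<Sum>i = 0..<p. ith_elem T (\<sigma> i))"
    using sum.reindex_bij_betw[OF bT, of "\<lambda>x. x"] by simp
  show "\<Sum>T \<le> \<Sum>S" unfolding sS sT using le by (rule sum_mono)
  assume "\<Sum>T = \<Sum>S"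
  then have "\<forall>i\<in>{0..<p}. ith_elem T (\<sigma> i) = ith_elem S i"
    unfolding sS sT
    using sum_mono_inv[of "\<lambda>i. ith_elem T (\<sigma> i)" "{0..<p}" "ith_elem S"] le by blast
  then have "(ith_elem T \<circ> \<sigma>) ` {0..<p} = ith_elem S ` {0..<p}" by (intro image_cong) auto
  then show "T = S" using bS bT by (simp add: bij_betw_def)
qed

lemma minor_lower_triangular_diag:
  fixes A :: "nat \<Rightarrow> nat \<Rightarrow> 'r::comm_ring_1"
  assumes A: "\<And>i j. i < j \<Longrightarrow> A i j = 0" and S: "finite S" "card S = p"
  shows "minor p A S S = (\<Prod>s\<in>S. A s s)"
proof -
  have "minor p A S S = prod_list (diag_mat (mat p p (\<lambda>(i, j). A (ith_elem S i) (ith_elem S j))))"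
    unfolding minor_def using A ith_elem_less[OF S] by (intro det_lower_triangular[of p]) auto
  also have "\<dots> = (\<Prod>i = 0..<p. A (ith_elem S i) (ith_elem S i))"
    by (simp add: prod_list_diag_prod)
  also have "\<dots> = (\<Prod>s\<in>S. A s s)"
    by (rule prod.reindex_bij_betw[OF bij_betw_ith_elem[OF S], of "\<lambda>s. A s s"])
  finally show ?thesis .
qed

lemma minor_transpose: "minor p (\<lambda>i j. A j i) S T = minor p A T S"
proof -
  have "mat p p (\<lambda>(i, j). A (ith_elem T j) (ith_elem S i)) =
      transpose_mat (mat p p (\<lambda>(i, j). A (ith_elem T i) (ith_elem S j)))"
    by (intro eq_matI) auto
  then show ?thesis
    unfolding minor_def using det_transpose[of _ p] by (metis mat_carrier)
qed

subsection \<open>Divided differences and the companion matrix\<close>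

text \<open>The falling factorial; truncated subtraction is harmless, because for
  \<open>k > m\<close> the factor with \<open>i = m\<close> is zero.\<close>

lemma fact_times_binomial_eq_prod: "fact k * (m choose k) = (\<Prod>i<k. m - i)" for m k :: nat
proof (induction k arbitrary: m)
  case (Suc k)
  show ?case
  proof (cases m)
    case (Suc m')
    have "fact (Suc k) * (m choose Suc k) = fact k * (Suc k * (Suc m' choose Suc k))"
      using Suc by (simp add: algebra_simps)
    also have "\<dots> = Suc m' * (fact k * (m' choose k))"
      by (simp only: Suc_times_binomial mult_ac)
    also have "\<dots> = (\<Prod>i<Suc k. m - i)"
      by (simp add: Suc.IH Suc prod.lessThan_Suc_shift del: prod.lessThan_Suc)
    finally show ?thesis .
  qed (simp add: prod.lessThan_Suc_shift del: prod.lessThan_Suc)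
qed simp

text \<open>In \<open>p * (n choose p) = n * ((n - 1) choose (p - 1))\<close> the last factor is
  prime to \<open>p\<close>: its numerators lie strictly between the consecutive multiples
  \<open>n - p\<close> and \<open>n\<close> of \<open>p\<close>. So the valuation drops by exactly
  one.\<close>

lemma multiplicity_binomial_less:
  fixes n p :: nat
  assumes p: "prime p" and dvd: "p dvd n" and n: "n \<ge> 1"
  shows "multiplicity p (n choose p) < multiplicity p n"
proof -
  have pn: "p \<le> n" "0 < p" using dvd n p by (auto simp: dvd_imp_le prime_gt_0_nat)
  have ch0: "n choose p \<noteq> 0" "(n - 1) choose (p - 1) \<noteq> 0" using pn by (auto simp: not_le)
  have "\<not> p dvd ((n - 1) choose (p - 1))"
  proof
    assume "p dvd ((n - 1) choose (p - 1))"
    then have "p dvd fact (p - 1) * ((n - 1) choose (p - 1))" by simp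
    also have "fact (p - 1) * ((n - 1) choose (p - 1)) = (\<Prod>i<p - 1. n - 1 - i)"
      by (rule fact_times_binomial_eq_prod)
    finally obtain i where i: "i < p - 1" "p dvd n - 1 - i"
      using p by (auto simp: prime_dvd_prod_iff)
    have "p dvd n - (n - 1 - i)" using dvd_diff_nat[OF dvd i(2)] .
    moreover have "n - (n - 1 - i) = Suc i" using i pn by simp
    ultimately show False using i(1) by (metis Suc_pred' dvd_imp_le less_Suc_eq_le not_less pn(2)
          zero_less_Suc Suc_less_eq)
  qed
  then have "multiplicity p ((n - 1) choose (p - 1)) = 0"
    by (rule not_dvd_imp_multiplicity_0)
  moreover have "p * (n choose p) = n * ((n - 1) choose (p - 1))"
    using times_binomial_minus1_eq[OF pn(2)] by simp
  then have "multiplicity p (p * (n choose p)) = multiplicity p (n * ((n - 1) choose (p - 1)))"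
    by simp
  ultimately show ?thesis
    using p ch0 n by (simp add: prime_elem_multiplicity_mult_distrib multiplicity_self)
qed

section \<open>Coefficient homomorphisms and divided differences\<close>

lemma map_poly_to_ac_hom: "comm_ring_hom (map_poly to_ac)"
  by unfold_locales
    (auto intro!: poly_eqI simp: coeff_map_poly coeff_mult to_ac_sum coeff_1)

lemma const_poly_hom: "comm_ring_hom (\<lambda>a :: 'r::comm_ring_1. [:a:])"
  by unfold_locales (simp_all add: one_pCons)

lemma minor_cong:
  assumes "S \<in> subsets_of_card n p" "T \<in> subsets_of_card n p"
    and "\<And>i j. i < n \<Longrightarrow> j < n \<Longrightarrow> A i j = B i j"
  shows "minor p A S T = minor p B S T"
proof -
  have "ith_elem U i < n" if "U \<in> subsets_of_card n p" "i < p" for U i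
    using bij_betw_ith_elem[of U p] subsets_of_cardD[OF that(1)] that(2)
    by (auto dest!: bij_betw_imp_surj_on)
  then show ?thesis
    unfolding minor_def using assms by (intro arg_cong[where f = det] eq_matI) auto
qed

text \<open>\<open>divdiff r j s\<close> is the divided difference of \<open>x ^ j\<close> at the points \<open>r 0, \<dots>, r s\<close>.\<close>

primrec divdiff :: "(nat \<Rightarrow> 'r::comm_ring_1) \<Rightarrow> nat \<Rightarrow> nat \<Rightarrow> 'r" where
  "divdiff r 0 s = (if s = 0 then 1 else 0)"
| "divdiff r (Suc j) s = r s * divdiff r j s + (if s = 0 then 0 else divdiff r j (s - 1))"

lemma divdiff_eq_0: "j < s \<Longrightarrow> divdiff r j s = 0"
  by (induction j arbitrary: s) auto

lemma divdiff_self: "divdiff r j j = 1"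
  by (induction j) (auto simp: divdiff_eq_0)

text \<open>The sum extends divided differences linearly from powers to polynomials. By the Leibniz
  rule a factor vanishing at the last point \<open>r s\<close> removes that point; for
  \<open>s = 0\<close> the sum is evaluation at \<open>r 0\<close>, which gives zero.\<close>

lemma divdiff_linear_factor:
  fixes r :: "nat \<Rightarrow> 'r::comm_ring_1"
  assumes "degree Q \<le> N"
  shows "(\<Sum>j\<le>Suc N. coeff ([:- r s, 1:] * Q) j * divdiff r j s) =
     (if s = 0 then 0 else \<Sum>j\<le>N. coeff Q j * divdiff r j (s - 1))"
proof -
  have Q: "coeff Q (Suc N) = 0" using assms by (simp add: coeff_eq_0)
  have "(\<Sum>j\<le>Suc N. coeff ([:- r s, 1:] * Q) j * divdiff r j s) =
      (\<Sum>j\<le>Suc N. coeff (pCons 0 Q) j * divdiff r j s) - r s * (\<Sum>j\<le>Suc N. coeff Q j * divdiff r j s)"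
    by (simp add: algebra_simps sum.distrib sum_distrib_left sum_subtractf del: sum.atMost_Suc)
  also have "(\<Sum>j\<le>Suc N. coeff (pCons 0 Q) j * divdiff r j s) = (\<Sum>j\<le>N. coeff Q j * divdiff r (Suc j) s)"
    by (subst sum.atMost_Suc_shift) simp
  also have "(\<Sum>j\<le>Suc N. coeff Q j * divdiff r j s) = (\<Sum>j\<le>N. coeff Q j * divdiff r j s)"
    using Q by simp
  finally show ?thesis
    by (auto simp: algebra_simps sum.distrib sum_distrib_left)
qed

text \<open>The functionals vanish on multiples of the root product, so they descend to the quotient
  ring. In the induction the last factor is absorbed into \<open>Q\<close> when
  \<open>s < m\<close>, and lowers \<open>s\<close> by one when \<open>s = m\<close>.\<close>

lemma divdiff_root_product:
  fixes r :: "nat \<Rightarrow> 'r::idom"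
  assumes "s < m" "degree ((\<Prod>i<m. [:- r i, 1:]) * Q) \<le> N"
  shows "(\<Sum>j\<le>N. coeff ((\<Prod>i<m. [:- r i, 1:]) * Q) j * divdiff r j s) = 0"
  using assms
proof (induction m arbitrary: s Q N)
  case (Suc m)
  show ?case
  proof (cases "s = m")
    case False
    then have "s < m" using Suc.prems by simp
    then show ?thesis
      using Suc.IH[of s "[:- r m, 1:] * Q" N] Suc.prems
      by (simp only: prod.lessThan_Suc mult.assoc)
  next
    case True
    let ?P = "(\<Prod>i<m. [:- r i, 1:]) * Q"
    have eq: "(\<Prod>i<Suc m. [:- r i, 1:]) * Q = [:- r s, 1:] * ?P"
      using True by (simp add: mult_ac)
    show ?thesis
    proof (cases "?P = 0")
      case True
      then show ?thesis unfolding eq by simp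
    next
      case False
      then have "degree ([:- r s, 1:] * ?P) = Suc (degree ?P)"
        by (subst degree_mult_eq) auto
      then obtain N' where N: "N = Suc N'" "degree ?P \<le> N'"
        using Suc.prems(2) unfolding eq by (cases N) auto
      have "s - 1 < m" if "s \<noteq> 0" using that True by simp
      then have "(if s = 0 then 0 else \<Sum>j\<le>N'. coeff ?P j * divdiff r j (s - 1)) = 0"
        using Suc.IH[of "s - 1" Q N'] N(2) by simp
      then show ?thesis
        unfolding eq N(1) divdiff_linear_factor[OF N(2)] .
    qed
  qed
qed simp


text \<open>
  In the basis \<open>1, x, \<dots>, x^(n-1)\<close>, multiplication by \<open>x\<close> on \<open>F[x]/(f)\<close> is the companion matrix; in
  the divided-difference functionals it becomes bidiagonal with the roots on the diagonal.
\<close>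

definition companion :: "'a::field poly \<Rightarrow> nat \<Rightarrow> nat \<Rightarrow> 'a" where
  "companion f i j =
     (if Suc j = degree f then - coeff f i / lead_coeff f else if i = Suc j then 1 else 0)"

definition bidiagonal :: "(nat \<Rightarrow> 'r::comm_ring_1) \<Rightarrow> nat \<Rightarrow> nat \<Rightarrow> 'r" where
  "bidiagonal r i j = (if i = j then r i else if i = Suc j then 1 else 0)"

text \<open>Minors of this matrix are polynomials; for each \<open>k\<close>, their coefficients of
  degree \<open>k\<close> form the matrix of one operator on the exterior power.\<close>

definition char_matrix :: "(nat \<Rightarrow> nat \<Rightarrow> 'r::comm_ring_1) \<Rightarrow> nat \<Rightarrow> nat \<Rightarrow> 'r poly" where
  "char_matrix M i j = (if i = j then [:0, 1:] else 0) - [:M i j:]"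

text \<open>Both sides are the divided difference of \<open>x ^ (j + 1)\<close> at
  \<open>r 0, ..., r s\<close>: the companion matrix multiplies by \<open>x\<close> modulo
  \<open>f\<close>, and the bidiagonal matrix encodes the recursion.\<close>

lemma divdiff_companion:
  fixes f :: "'a::field poly" and r :: "nat \<Rightarrow> 'a alg_closure"
  assumes f: "f \<noteq> 0" and n: "n = degree f"
    and roots: "map_poly to_ac f = smult (to_ac (lead_coeff f)) (\<Prod>i<n. [:- r i, 1:])"
    and s: "s < n" and j: "j < n"
  shows "(\<Sum>k<n. divdiff r k s * to_ac (companion f k j)) = (\<Sum>k<n. bidiagonal r s k * divdiff r j k)"
proof -
  have "(\<Sum>k<n. bidiagonal r s k * divdiff r j k) =
      (\<Sum>k<n. (if k = s then r s * divdiff r j s else 0) + (if Suc k = s then divdiff r j k else 0))"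
    by (intro sum.cong) (auto simp: bidiagonal_def)
  also have "\<dots> = r s * divdiff r j s + (\<Sum>k<n. if Suc k = s then divdiff r j k else 0)"
    using s by (simp add: sum.distrib)
  also have "(\<Sum>k<n. if Suc k = s then divdiff r j k else 0) = (if s = 0 then 0 else divdiff r j (s - 1))"
  proof (cases s)
    case (Suc s')
    then show ?thesis using s by simp
  qed simp
  finally have rhs: "(\<Sum>k<n. bidiagonal r s k * divdiff r j k) = divdiff r (Suc j) s" by simp
  show ?thesis
  proof (cases "Suc j = n")
    case False
    then have "(\<Sum>k<n. divdiff r k s * to_ac (companion f k j)) =
        (\<Sum>k<n. if k = Suc j then divdiff r k s else 0)"
      by (intro sum.cong) (auto simp: companion_def n)
    also have "\<dots> = divdiff r (Suc j) s" using False j by simp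
    finally show ?thesis using rhs by simp
  next
    case True
    \<comment> \<open>In the last column \<open>x ^ n\<close> is reduced modulo \<open>f\<close>.
      This leaves the functional unchanged, since it vanishes on the monic multiple
      \<open>?P\<close> of \<open>f\<close>.\<close>
    let ?P = "\<Prod>i<n. [:- r i, 1:]"
    have coeff: "coeff ?P i = to_ac (coeff f i / lead_coeff f)" for i
    proof -
      have "to_ac (coeff f i) = to_ac (lead_coeff f) * coeff ?P i"
        using arg_cong[OF roots, of "\<lambda>q. coeff q i"] by (simp add: coeff_map_poly)
      then show ?thesis using f by (simp add: field_simps)
    qed
    have "degree ?P \<le> n"
      using f n arg_cong[OF roots, of degree] by (simp add: degree_map_poly)
    then have "(\<Sum>i\<le>n. coeff ?P i * divdiff r i s) = 0"
      using divdiff_root_product[OF s, of r 1 n] by simp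
    then have "- (\<Sum>i<n. coeff ?P i * divdiff r i s) = divdiff r n s"
      using f n coeff[of n] by (intro minus_unique) (simp add: lessThan_Suc_atMost[symmetric])
    moreover have "(\<Sum>k<n. divdiff r k s * to_ac (companion f k j)) = - (\<Sum>i<n. coeff ?P i * divdiff r i s)"
      unfolding sum_negf[symmetric] coeff
      using True n by (intro sum.cong) (auto simp: companion_def)
    ultimately show ?thesis using rhs True by simp
  qed
qed

text \<open>\<open>divdiff_companion\<close> intertwines the two characteristic matrices over the
  polynomial ring, with divided differences as constant polynomials. Cauchy-Binet carries this
  identity to the compounds, and coefficients of degree \<open>k\<close> are compared.\<close>

lemma compound_char_matrix:
  fixes f :: "'a::field poly" and r :: "nat \<Rightarrow> 'a alg_closure"
  assumes f: "f \<noteq> 0" and n: "n = degree f"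
    and roots: "map_poly to_ac f = smult (to_ac (lead_coeff f)) (\<Prod>i<n. [:- r i, 1:])"
    and S: "S \<in> subsets_of_card n p" and U: "U \<in> subsets_of_card n p"
  shows "(\<Sum>T\<in>subsets_of_card n p. minor p (\<lambda>s j. divdiff r j s) S T *
            to_ac (coeff (minor p (char_matrix (companion f)) T U) k)) =
         (\<Sum>T\<in>subsets_of_card n p. coeff (minor p (char_matrix (bidiagonal r)) S T) k *
            minor p (\<lambda>s j. divdiff r j s) T U)"
proof -
  let ?D = "\<lambda>s j. divdiff r j s" and ?I = "subsets_of_card n p"
  interpret m: comm_ring_hom "map_poly (to_ac :: 'a \<Rightarrow> _)" by (rule map_poly_to_ac_hom)
  interpret c: comm_ring_hom "\<lambda>a :: 'a alg_closure. [:a:]" by (rule const_poly_hom)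
  have ch: "map_poly to_ac (char_matrix (companion f) i j) =
      char_matrix (\<lambda>i j. to_ac (companion f i j)) i j" for i j
    by (simp add: char_matrix_def m.hom_minus map_poly_pCons)
  have prod: "(\<Sum>k<n. [:?D s k:] * char_matrix (\<lambda>i j. to_ac (companion f i j)) k j) =
      (\<Sum>k<n. char_matrix (bidiagonal r) s k * [:?D k j:])" if "s < n" "j < n" for s j
  proof -
    have "(\<Sum>k<n. [:?D s k:] * char_matrix (\<lambda>i j. to_ac (companion f i j)) k j) =
        (\<Sum>k<n. if k = j then [:0, ?D s j:] else 0) - [:\<Sum>k<n. ?D s k * to_ac (companion f k j):]"
      unfolding c.hom_sum sum_subtractf[symmetric]
      by (intro sum.cong) (auto simp: char_matrix_def algebra_simps)
    also have "\<dots> = (\<Sum>k<n. if k = s then [:0, ?D s j:] else 0) - [:\<Sum>k<n. bidiagonal r s k * ?D k j:]"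
      using that by (simp add: divdiff_companion[OF f n roots that])
    also have "\<dots> = (\<Sum>k<n. char_matrix (bidiagonal r) s k * [:?D k j:])"
      unfolding c.hom_sum sum_subtractf[symmetric]
      by (intro sum.cong) (auto simp: char_matrix_def algebra_simps)
    finally show ?thesis .
  qed
  have "(\<Sum>T\<in>?I. [:minor p ?D S T:] * map_poly to_ac (minor p (char_matrix (companion f)) T U)) =
      (\<Sum>T\<in>?I. minor p (\<lambda>i j. [:?D i j:]) S T * minor p (char_matrix (\<lambda>i j. to_ac (companion f i j))) T U)"
    unfolding c.hom_minor m.hom_minor ch ..
  also have "\<dots> = minor p (\<lambda>s j. \<Sum>k<n. [:?D s k:] * char_matrix (\<lambda>i j. to_ac (companion f i j)) k j) S U"
    by (rule Cauchy_Binet[symmetric])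
  also have "\<dots> = minor p (\<lambda>s j. \<Sum>k<n. char_matrix (bidiagonal r) s k * [:?D k j:]) S U"
    by (rule minor_cong[OF S U prod])
  also have "\<dots> = (\<Sum>T\<in>?I. minor p (char_matrix (bidiagonal r)) S T * minor p (\<lambda>i j. [:?D i j:]) T U)"
    by (rule Cauchy_Binet)
  also have "\<dots> = (\<Sum>T\<in>?I. minor p (char_matrix (bidiagonal r)) S T * [:minor p ?D T U:])"
    unfolding c.hom_minor ..
  finally show ?thesis
    by (simp add: poly_eq_iff coeff_sum coeff_map_poly mult.commute)
qed

text \<open>Division by a monic polynomial stays in \<open>K\<close>: the leading coefficient of
  \<open>h\<close> is that of \<open>g * h\<close>, and removing the top monomial of
  \<open>h\<close> lowers its degree.\<close>

lemma coeffs_cofactor_in_field: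
  assumes K: "extension_field K" and g: "\<And>k. coeff g k \<in> K" "lead_coeff g = 1"
    and gh: "\<And>k. coeff (g * h) k \<in> K"
  shows "coeff h k \<in> K"
  using gh
proof (induction "degree h" arbitrary: h k rule: less_induct)
  case less
  have K0: "0 \<in> K" using K by (metis extension_field_def range_subsetD to_ac_0)
  show ?case
  proof (cases "h = 0")
    case True
    then show ?thesis using K0 by simp
  next
    case False
    let ?l = "lead_coeff h" and ?d = "degree h"
    have "g \<noteq> 0" using g(2) by auto
    then have "coeff (g * h) (degree g + ?d) = ?l"
      using g(2) by (simp add: coeff_mult_degree_sum)
    then have l: "?l \<in> K" using less.prems by metis
    let ?h' = "h - monom ?l ?d"
    have h': "coeff (g * ?h') i \<in> K" for i
    proof -
      have "coeff (g * ?h') i = coeff (g * h) i + - (if ?d \<le> i then ?l * coeff g (i - ?d) else 0)"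
        by (simp add: right_diff_distrib mult.commute[of g "monom _ _"] coeff_monom_mult)
      moreover have "(if ?d \<le> i then ?l * coeff g (i - ?d) else 0) \<in> K"
        using K l g(1) K0 by (simp add: extension_field_def)
      ultimately show ?thesis
        using K less.prems by (simp only: extension_field_def)
    qed
    have "coeff ?h' k \<in> K"
    proof (cases "?d = 0")
      case True
      then have "?h' = 0" by (auto elim!: degree_eq_zeroE simp: monom_0)
      then show ?thesis using K0 by simp
    next
      case False
      have "degree ?h' < ?d"
      proof (rule degree_lessI)
        show "?h' \<noteq> 0 \<or> 0 < ?d" using False by simp
        show "\<forall>k\<ge>?d. coeff ?h' k = 0" by (auto simp: coeff_eq_0)
      qed
      then show ?thesis using less.hyps h' by blast
    qed
    then show ?thesis
      using l K by (cases "k = ?d") (auto simp: extension_field_def)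
  qed
qed

subsection \<open>The field containing the coefficients of a factor\<close>

definition fun_scale :: "'a::field \<Rightarrow> ('i \<Rightarrow> 'a) \<Rightarrow> 'i \<Rightarrow> 'a" where
  "fun_scale a v = (\<lambda>i. a * v i)"

lemma vector_space_fun_scale: "vector_space fun_scale"
  by unfold_locales (auto simp: fun_scale_def algebra_simps fun_eq_iff)

lemma sum_fun_apply: "(\<Sum>x\<in>A. f x) i = (\<Sum>x\<in>A. f x i)"
  for f :: "'b \<Rightarrow> 'i \<Rightarrow> 'a::comm_monoid_add"
  by (induction A rule: infinite_finite_induct) auto

text \<open>With the \<open>p\<close>-subsets as \<open>I\<close>, these are coordinate vectors of
  the exterior power; vanishing outside \<open>I\<close> makes the unit vectors a finite
  basis.\<close>

lemma supported_functions:
  fixes I :: "'i set"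
  defines "W \<equiv> {v :: 'i \<Rightarrow> 'a::field. \<forall>i. i \<notin> I \<longrightarrow> v i = 0}"
  assumes I: "finite I"
  shows "vector_space.fin_gen fun_scale W" "vector_space.dim fun_scale W = card I"
proof -
  interpret vector_space "fun_scale :: 'a \<Rightarrow> ('i \<Rightarrow> 'a) \<Rightarrow> _" by (rule vector_space_fun_scale)
  define e :: "'i \<Rightarrow> 'i \<Rightarrow> 'a" where "e i = (\<lambda>j. if j = i then 1 else 0)" for i
  have inj: "inj_on e I"
    by (rule inj_onI) (metis e_def zero_neq_one)
  have lc: "(\<Sum>b\<in>e ` I. fun_scale (u b) b) = (\<lambda>j. if j \<in> I then u (e j) else 0)" for u
  proof
    fix j
    have "(\<Sum>b\<in>e ` I. fun_scale (u b) b) j = (\<Sum>i\<in>I. if i = j then u (e j) else 0)"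
      unfolding sum_fun_apply sum.reindex[OF inj]
      by (intro sum.cong) (auto simp: fun_scale_def e_def)
    then show "(\<Sum>b\<in>e ` I. fun_scale (u b) b) j = (if j \<in> I then u (e j) else 0)"
      using I by simp
  qed
  have sub: "subspace W"
    by (auto simp: subspace_def W_def fun_scale_def)
  have W: "W = span (e ` I)"
  proof
    show "span (e ` I) \<subseteq> W"
      by (intro span_minimal sub) (auto simp: W_def e_def)
    show "W \<subseteq> span (e ` I)"
    proof
      fix v assume "v \<in> W"
      then have "v = (\<Sum>b\<in>e ` I. fun_scale (v (inv_into I e b)) b)"
        unfolding lc using inj by (auto simp: W_def fun_eq_iff)
      also have "\<dots> \<in> span (e ` I)"
        by (intro span_sum span_scale span_base)
      finally show "v \<in> span (e ` I)" .
    qed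
  qed
  show "local.fin_gen W"
    unfolding local.fin_gen_def using sub W I by blast
  have "independent (e ` I)"
  proof (rule independent_if_scalars_zero)
    show "finite (e ` I)" using I by simp
    fix u b assume u: "(\<Sum>b\<in>e ` I. fun_scale (u b) b) = 0" and "b \<in> e ` I"
    then obtain j where "j \<in> I" "b = e j" by blast
    then show "u b = 0" using fun_cong[OF u[unfolded lc], of j] by simp
  qed
  then show "dim W = card I"
    unfolding W by (simp add: dim_eq_card_independent card_image[OF inj])
qed

lemma linear_functional_to_ac:
  "Vector_Spaces.linear fun_scale ac_scale (\<lambda>v. \<Sum>i\<in>I. d i * to_ac (v i))"
  by (intro Vector_Spaces.linear_iff[THEN iffD2] conjI vector_space_fun_scale ac.vector_space_axioms)
    (simp_all add: fun_scale_def ac_scale_def algebra_simps sum.distrib sum_distrib_left)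

text \<open>\<open>triangular_eigenfunctionals\<close> is applied to the exterior power with the
  element sum of a \<open>p\<close>-subset as rank. The eigenvalues come from the diagonal of the
  compound of \<open>char_matrix (bidiagonal r)\<close>, whose entries are products of linear
  factors.\<close>

lemma exists_field_containing_factor:
  fixes f :: "'a::field poly" and r :: "nat \<Rightarrow> 'a alg_closure"
  assumes f: "f \<noteq> 0" and n: "n = degree f"
    and roots: "map_poly to_ac f = smult (to_ac (lead_coeff f)) (\<Prod>i<n. [:- r i, 1:])"
    and q: "\<not> q dvd n choose p"
  shows "\<exists>S\<in>subsets_of_card n p. \<exists>K. extension_field K \<and> ac.fin_gen K \<and>
           range (coeff (\<Prod>s\<in>S. [:- r s, 1:])) \<subseteq> K \<and>
           ac.dim K > 0 \<and> \<not> q dvd ac.dim K \<and> ac.dim K \<le> n choose p"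
proof -
  let ?I = "subsets_of_card n p" and ?D = "\<lambda>s j. divdiff r j s"
  let ?c = "minor p (char_matrix (companion f))" and ?b = "minor p (char_matrix (bidiagonal r))"
  note fin = finite_subsets_of_card[of n p]
  note ID = subsets_of_cardD
  \<comment> \<open>\<open>L S\<close> is row \<open>S\<close> of the compound of the
    divided-difference matrix; \<open>E k\<close> is the degree \<open>k\<close> coefficient of the
    compound of the companion characteristic matrix.\<close>
  define L where "L S v = (\<Sum>T\<in>?I. minor p ?D S T * to_ac (v T))" for S and v :: "nat set \<Rightarrow> 'a"
  define E where "E k v = (\<lambda>T. if T \<in> ?I then \<Sum>U\<in>?I. coeff (?c T U) k * v U else 0)"
    for k and v :: "nat set \<Rightarrow> 'a"
  have low: "char_matrix (bidiagonal r) i j = 0" if "i < j" for i j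
    using that by (simp add: char_matrix_def bidiagonal_def)
  have LE: "L S (E k v) = (\<Sum>T\<in>?I. coeff (?b S T) k * L T v)" if S: "S \<in> ?I" for S k v
  proof -
    have "L S (E k v) = (\<Sum>T\<in>?I. \<Sum>U\<in>?I. minor p ?D S T * to_ac (coeff (?c T U) k) * to_ac (v U))"
      unfolding L_def E_def by (simp add: to_ac_sum sum_distrib_left mult_ac)
    also have "\<dots> = (\<Sum>U\<in>?I. (\<Sum>T\<in>?I. minor p ?D S T * to_ac (coeff (?c T U) k)) * to_ac (v U))"
      by (subst sum.swap) (simp add: sum_distrib_right)
    also have "\<dots> = (\<Sum>U\<in>?I. (\<Sum>T\<in>?I. coeff (?b S T) k * minor p ?D T U) * to_ac (v U))"
      by (intro sum.cong refl arg_cong2[where f = "(*)"] compound_char_matrix[OF f n roots S])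
    also have "\<dots> = (\<Sum>T\<in>?I. \<Sum>U\<in>?I. coeff (?b S T) k * minor p ?D T U * to_ac (v U))"
      by (subst sum.swap) (simp add: sum_distrib_right)
    finally show ?thesis
      unfolding L_def by (simp add: sum_distrib_left mult_ac)
  qed
  let ?W = "{v :: nat set \<Rightarrow> 'a. \<forall>T. T \<notin> ?I \<longrightarrow> v T = 0}"
  note W = supported_functions[OF fin, where 'a = 'a]
  have dimW: "vector_space.dim fun_scale ?W = n choose p"
    using W(2) card_subsets_of_card by simp
  have "\<exists>S\<in>?I. \<exists>K. extension_field K \<and> ac.fin_gen K \<and>
           range (\<lambda>k. coeff (?b S S) k) \<subseteq> K \<and>
           ac.dim K > 0 \<and> \<not> q dvd ac.dim K \<and> ac.dim K \<le> vector_space.dim fun_scale ?W"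
  proof (rule triangular_eigenfunctionals[OF vector_space_fun_scale fin, of L _ E "\<lambda>S. \<Sum>S"])
    show "Vector_Spaces.linear fun_scale ac_scale (L S)" for S
      unfolding L_def[abs_def] by (rule linear_functional_to_ac)
    show "vector_space.fin_gen fun_scale ?W" by (rule W)
    show "E k v \<in> ?W" for k v by (simp add: E_def)
    show "\<not> q dvd vector_space.dim fun_scale ?W" using q dimW by simp
    show "L S (E k v) = coeff (?b S S) k * L S v"
      if S: "S \<in> ?I" and z: "\<And>T. T \<in> ?I \<Longrightarrow> \<Sum>T < \<Sum>S \<Longrightarrow> L T v = 0" for S k v
    proof -
      \<comment> \<open>A nonzero off-diagonal entry forces a smaller element sum, and there
        \<open>L T\<close> vanishes on \<open>v\<close>.\<close>
      have "coeff (?b S T) k * L T v = 0" if T: "T \<in> ?I - {S}" for T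
      proof (cases "?b S T = 0")
        case False
        have TI: "T \<in> ?I" using T by blast
        note m = minor_lower_triangular[OF low ID(1,2)[OF S] ID(1,2)[OF TI] False]
        have "\<Sum>T < \<Sum>S" using m T by (auto simp: order_less_le)
        then show ?thesis using z T by simp
      qed simp
      then have "(\<Sum>T\<in>?I - {S}. coeff (?b S T) k * L T v) = 0" by (rule sum.neutral[rule_format])
      then show ?thesis
        unfolding LE[OF S] by (simp add: sum.remove[OF fin S])
    qed
    show "v = 0" if v: "v \<in> ?W" and z: "\<And>S. S \<in> ?I \<Longrightarrow> L S v = 0" for v
    proof (rule ccontr)
      assume "v \<noteq> 0"
      \<comment> \<open>Take \<open>T\<close> of maximal element sum in the support of
        \<open>v\<close>. The compound of \<open>?D\<close> is unitriangular, so only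
        \<open>T\<close> contributes to \<open>L T v\<close>, with coefficient 1.\<close>
      then obtain T0 where "T0 \<in> ?I \<and> v T0 \<noteq> 0" using v by (auto simp: fun_eq_iff)
      moreover have "finite ((\<lambda>T. \<Sum>T) ` ?I)" using fin by simp
      ultimately obtain T where T: "T \<in> ?I" "v T \<noteq> 0"
          and max: "\<And>U. U \<in> ?I \<Longrightarrow> v U \<noteq> 0 \<Longrightarrow> \<Sum>U \<le> \<Sum>T"
        using ex_has_greatest_nat[of "\<lambda>T. T \<in> ?I \<and> v T \<noteq> 0" T0 "\<lambda>T. \<Sum>T" "Suc (Max ((\<lambda>T. \<Sum>T) ` ?I))"]
        by (metis Max_ge image_eqI less_Suc_eq_le)
      have D0: "minor p ?D T U * to_ac (v U) = 0" if U: "U \<in> ?I - {T}" for U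
      proof (cases "minor p ?D T U = 0 \<or> v U = 0")
        case False
        \<comment> \<open>\<open>?D\<close> is upper triangular, so its transpose
          \<open>divdiff r\<close> is the matrix to which the triangularity lemma applies.\<close>
        then have nz: "minor p (divdiff r) U T \<noteq> 0"
          using minor_transpose[of p "divdiff r" T U] by simp
        note m = minor_lower_triangular[OF divdiff_eq_0 ID(1,2)[of U] ID(1,2)[OF T(1)] nz]
        have "\<Sum>T \<le> \<Sum>U" "\<Sum>U \<le> \<Sum>T" using m(1) U max False by auto
        then show ?thesis using m(2) U by auto
      qed auto
      have "L T v = minor p ?D T T * to_ac (v T)"
        unfolding L_def sum.remove[OF fin T(1)] using D0 by (simp add: sum.neutral)
      also have "minor p ?D T T = 1"
        using minor_transpose[of p "divdiff r" T T]
          minor_lower_triangular_diag[where A = "divdiff r", OF divdiff_eq_0 ID(1,2)[OF T(1)]]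
        by (simp add: divdiff_self)
      finally show False using z T by simp
    qed
  qed
  then obtain S K where S: "S \<in> ?I" and K: "extension_field K" "ac.fin_gen K"
      "range (coeff (?b S S)) \<subseteq> K"
      "ac.dim K > 0" "\<not> q dvd ac.dim K" "ac.dim K \<le> n choose p"
    unfolding dimW by blast
  have "?b S S = (\<Prod>s\<in>S. [:- r s, 1:])"
    using minor_lower_triangular_diag[where A = "char_matrix (bidiagonal r)", OF low ID(1,2)[OF S]]
    by (simp add: char_matrix_def bidiagonal_def)
  then show ?thesis using S K by metis
qed

section \<open>Splitting the polynomial and choosing the field\<close>

text \<open>Listing the multiset of roots gives each occurrence its own index, so choosing subsets
  of indices also handles repeated roots.\<close>

lemma alg_closure_split:
  fixes f :: "'a::field poly"
  assumes "f \<noteq> 0"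
  obtains r :: "nat \<Rightarrow> 'a alg_closure"
    where "map_poly to_ac f = smult (to_ac (lead_coeff f)) (\<Prod>i<degree f. [:- r i, 1:])"
proof -
  have deg: "degree (map_poly to_ac f) = degree f" by (simp add: degree_map_poly)
  have "map_poly to_ac f \<noteq> 0" using assms by (simp add: map_poly_eq_0_iff)
  then obtain A where A: "size A = degree f"
      "map_poly to_ac f = smult (lead_coeff (map_poly to_ac f)) (\<Prod>x\<in>#A. [:-x, 1:])"
    using alg_closed_imp_factorization deg by metis
  obtain xs where xs: "mset xs = A" using ex_mset by blast
  have "(\<Prod>x\<in>#A. [:-x, 1:]) = prod_list (map (\<lambda>x. [:-x, 1:]) xs)"
    unfolding xs[symmetric] by (simp flip: prod_mset_prod_list)
  also have "\<dots> = (\<Prod>i<degree f. [:- (xs ! i), 1:])"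
    using A(1) xs by (auto simp: prod.list_conv_set_nth lessThan_atLeast0)
  finally show ?thesis
    using that A(2) deg by (simp add: coeff_map_poly)
qed

theorem theorem4p9:
  fixes f :: "'a::field poly" and n p :: nat
  assumes "n = degree f" and "n \<ge> 1"
    and "prime p" and "p dvd n"
  shows "\<exists>K :: 'a alg_closure set.
           algebraic_extension K \<and> finite_extension K \<and>
           (\<exists>g. factor_over K g f \<and> degree g = p) \<and>
           ext_degree K \<le> n choose p \<and>
           multiplicity p (ext_degree K) < multiplicity p n"
proof -
  have f0: "f \<noteq> 0" using assms by auto
  obtain r :: "nat \<Rightarrow> 'a alg_closure"
    where r: "map_poly to_ac f = smult (to_ac (lead_coeff f)) (\<Prod>i<n. [:- r i, 1:])"
    using alg_closure_split[OF f0] assms(1) by blast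
  have p: "\<not> is_unit p" using assms(3) by (simp add: prime_nat_iff)
  have "p \<le> n" using assms by (auto simp: dvd_imp_le)
  then have "n choose p \<noteq> 0" by (simp add: not_le)
  \<comment> \<open>The number to avoid as a divisor is the full power of \<open>p\<close> in
    \<open>n\<close>, since the binomial coefficient has smaller valuation.\<close>
  then have "\<not> p ^ multiplicity p n dvd n choose p"
    using multiplicity_binomial_less[OF assms(3,4,2)] p by (simp add: power_dvd_iff_le_multiplicity)
  from exists_field_containing_factor[OF f0 assms(1) r this]
  obtain S K where S: "S \<in> subsets_of_card n p" and K: "extension_field K" "ac.fin_gen K"
      "range (coeff (\<Prod>s\<in>S. [:- r s, 1:])) \<subseteq> K"
      "ac.dim K > 0" "\<not> p ^ multiplicity p n dvd ac.dim K" "ac.dim K \<le> n choose p"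
    by blast
  define g where "g = (\<Prod>s\<in>S. [:- r s, 1:])"
  define h where "h = smult (to_ac (lead_coeff f)) (\<Prod>s\<in>{..<n} - S. [:- r s, 1:])"
  note Sd = subsets_of_cardD[OF S]
  have gh: "map_poly to_ac f = g * h"
    unfolding r g_def h_def prod.subset_diff[OF Sd(3) finite_lessThan] by (simp add: mult.commute)
  have gK: "coeff g k \<in> K" for k using K(3) by (auto simp: g_def)
  have "degree g = (\<Sum>s\<in>S. degree [:- r s, 1:])"
    unfolding g_def by (rule degree_prod_eq_sum_degree) auto
  then have deg: "degree g = p" using Sd(2) by simp
  have "lead_coeff g = 1" unfolding g_def by (simp add: lead_coeff_prod)
  \<comment> \<open>The product is \<open>f\<close>, whose coefficients lie in the base field, and
    \<open>g\<close> is monic, so the cofactor has coefficients in \<open>K\<close> too.\<close>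
  moreover have "coeff (g * h) k \<in> K" for k
    unfolding gh[symmetric] using K(1) by (auto simp: coeff_map_poly extension_field_def)
  ultimately have hK: "coeff h k \<in> K" for k
    using coeffs_cofactor_in_field[OF K(1) gK] by blast
  have "factor_over K g f"
    unfolding factor_over_def using gh gK hK by (auto simp: coeffs_def)
  moreover have "algebraic_extension K"
    unfolding algebraic_extension_def using K(1) alg_closure_algebraic by metis
  moreover have "finite_extension K"
    unfolding finite_extension_def using K(1) ac.fin_gen_basisE[OF K(2)] by metis
  \<comment> \<open>As \<open>ac.dim K\<close> is nonzero, not being divisible by this power of
    \<open>p\<close> means exactly having smaller valuation.\<close>
  moreover have "multiplicity p (ac.dim K) < multiplicity p n"
    using K(4,5) p by (simp add: power_dvd_iff_le_multiplicity)
  ultimately show ?thesis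
    using deg K(6) unfolding ext_degree_def by blast
qed

end
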